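(* Let $M,N,S$ be positive integers with $M>N$, and let $Q$ denote the I/O complexity (minimum number of Load moves over all complete red-white pebble games with $S$ red pebbles) of the CDAG of the Householder QR program (A2V part) below applied to an $M\times N$ matrix $A$. Then $$\frac{(3M-N)N^2(M-N)^2}{24(MS+(M-N)^2)} \leq Q .$$
   Context: Program (Householder QR, A2V part, corresponding to LAPACK GEQR2), with input $M\times N$ array $A$, array $tau$ of length $N$, scalars $norma2$, $norma$: for k = 0,...,N-1: norma2 = 0.0 for i = k+1,...,M-1: norma2 += A[i][k]*A[i][k] norma = sqrt(A[k][k]*A[k][k] + norma2) A[k][k] = (A[k][k] > 0) ? (A[k][k] + norma) : (A[k][k] - norma) tau[k] = 2.0 / (1.0 + norma2 / (A[k][k]*A[k][k])) for i = k+1,...,M-1: A[i][k] /= A[k][k] A[k][k] = (A[k][k] > 0) ? (-norma) : (norma) for j = k+1,...,N-1: tau[j] = A[k][j] for i = k+1,...,M-1: tau[j] += A[i][k]*A[i][j] tau[j] = tau[k]*tau[j] A[k][j] = A[k][j] - tau[j] for i = k+1,...,M-1: A[i][j] = A[i][j] - A[i][k]*tau[j] CDAG of a program: a directed acyclic graph whose nodes are the input values (initial values of array entries read before being written) and the statement instances (each execution of an assignment statement, including compound assignments), with an edge $u\to v$ whenever the instance $v$ reads a value produced by $u$ (flow dependence). Input nodes have no incoming edges. Red-white pebble game with $S$ red pebbles on a CDAG: initially only the input nodes carry white pebbles and there are no red pebbles. Allowed moves: (Spill) remove a red pebble from a node; (Compute) if a node has no white pebble and all its predecessors carry red pebbles,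 place a white and a red pebble on it; (Load) place a red pebble on a node carrying a white pebble. At no time may more than $S$ red pebbles be on the graph. The game is complete when every node carries a white pebble. The I/O complexity $Q$ is the minimum, over all complete games, of the number of Load moves. *)

theory Defs
  imports "HOL-Library.Extended_Real"
begin

datatype ('l, 's) node = Input 'l | Inst 's

record ('l, 's) cdag =
  nodes :: "('l, 's) node set"
  inputs :: "('l, 's) node set"
  edges :: "(('l, 's) node \<times> ('l, 's) node) set"

text \<open>
  An execution is the list of its statement instances, in execution order and without
  repetition. Each instance \<open>s\<close> reads the locations \<open>rd s\<close> and then
  writes the single location \<open>wr s\<close>. A read of \<open>l\<close> at position \<open>q\<close>
  takes its value from the last instance before \<open>q\<close> that writes \<open>l\<close>, and
  from the initial content of \<open>l\<close> if there is none.
\<close>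

definition reads_initial ::
  "('s \<Rightarrow> 'l) \<Rightarrow> ('s \<Rightarrow> 'l set) \<Rightarrow> 's list \<Rightarrow> 'l \<Rightarrow> nat \<Rightarrow> bool" where
  "reads_initial wr rd t l q \<longleftrightarrow>
     q < length t \<and> l \<in> rd (t ! q) \<and> (\<forall>r<q. wr (t ! r) \<noteq> l)"

definition flow_dep ::
  "('s \<Rightarrow> 'l) \<Rightarrow> ('s \<Rightarrow> 'l set) \<Rightarrow> 's list \<Rightarrow> nat \<Rightarrow> nat \<Rightarrow> bool" where
  "flow_dep wr rd t p q \<longleftrightarrow>
     p < q \<and> q < length t \<and> wr (t ! p) \<in> rd (t ! q) \<and>
     (\<forall>r. p < r \<and> r < q \<longrightarrow> wr (t ! r) \<noteq> wr (t ! p))"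

definition cdag_of ::
  "('s \<Rightarrow> 'l) \<Rightarrow> ('s \<Rightarrow> 'l set) \<Rightarrow> 's list \<Rightarrow> ('l, 's) cdag" where
  "cdag_of wr rd t =
     (let ins = Input ` {l. \<exists>q. reads_initial wr rd t l q}
      in \<lparr> nodes = ins \<union> Inst ` set t,
           inputs = ins,
           edges = {(Input l, Inst (t ! q)) | l q. reads_initial wr rd t l q}
                 \<union> {(Inst (t ! p), Inst (t ! q)) | p q. flow_dep wr rd t p q} \<rparr>)"

datatype 'v move = Spill 'v | Compute 'v | Load 'v

definition preds :: "('l, 's) cdag \<Rightarrow> ('l, 's) node \<Rightarrow> ('l, 's) node set" where
  "preds G v = {u. (u, v) \<in> edges G}"

text \<open>
  \<open>plays G S ms R W\<close>: the legal move sequence \<open>ms\<close>, played from the initial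
  position with at most \<open>S\<close> red pebbles, ends with red pebbles on \<open>R\<close> and
  white pebbles on \<open>W\<close>.
\<close>

inductive plays ::
  "('l, 's) cdag \<Rightarrow> nat \<Rightarrow> ('l, 's) node move list \<Rightarrow>
   ('l, 's) node set \<Rightarrow> ('l, 's) node set \<Rightarrow> bool"
  for G :: "('l, 's) cdag" and S :: nat where
  start: "plays G S [] {} (inputs G)"
| spill: "plays G S ms R W \<Longrightarrow> v \<in> R \<Longrightarrow> plays G S (ms @ [Spill v]) (R - {v}) W"
| compute: "plays G S ms R W \<Longrightarrow> v \<in> nodes G \<Longrightarrow> v \<notin> W \<Longrightarrow> preds G v \<subseteq> R \<Longrightarrow>
    card (insert v R) \<le> S \<Longrightarrow> plays G S (ms @ [Compute v]) (insert v R) (insert v W)"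
| load: "plays G S ms R W \<Longrightarrow> v \<in> W \<Longrightarrow>
    card (insert v R) \<le> S \<Longrightarrow> plays G S (ms @ [Load v]) (insert v R) W"

definition complete_game ::
  "('l, 's) cdag \<Rightarrow> nat \<Rightarrow> ('l, 's) node move list \<Rightarrow> bool" where
  "complete_game G S ms \<longleftrightarrow> (\<exists>R W. plays G S ms R W \<and> nodes G \<subseteq> W)"

definition num_loads :: "'v move list \<Rightarrow> nat" where
  "num_loads ms = length (filter (\<lambda>m. \<exists>v. m = Load v) ms)"

text \<open>
  The minimum is attained whenever a complete game exists; if \<open>S\<close> is too small for
  any complete game, the value is \<open>\<infinity>\<close>.
\<close>

definition io_complexity :: "('l, 's) cdag \<Rightarrow> nat \<Rightarrow> enat" where
  "io_complexity G S = (INF ms \<in> {ms. complete_game G S ms}. enat (num_loads ms))"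

datatype loc = LA nat nat | LTau nat | LNorma2 | LNorma

text \<open>
  Statement instances of the unblocked Householder QR factorization (LAPACK GEQR2).
  The outer iteration \<open>k\<close> comes first, then \<open>j\<close> (if present), then \<open>i\<close>.
  Both branches of each conditional expression read the same locations, so the trace and
  its accesses do not depend on the data.
\<close>

datatype stmt =
    Norma2_zero nat           \<comment> \<open>\<open>norma2 = 0.0\<close>\<close>
  | Norma2_add nat nat        \<comment> \<open>\<open>norma2 += A[i][k]*A[i][k]\<close>\<close>
  | Norma_sqrt nat            \<comment> \<open>\<open>norma = sqrt(A[k][k]*A[k][k] + norma2)\<close>\<close>
  | Diag_shift nat            \<comment> \<open>\<open>A[k][k] = (A[k][k] > 0) ? (A[k][k] + norma) : (A[k][k] - norma)\<close>\<close>
  | Tau_diag nat              \<comment> \<open>\<open>tau[k] = 2.0 / (1.0 + norma2 / (A[k][k]*A[k][k]))\<close>\<close>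
  | Col_scale nat nat         \<comment> \<open>\<open>A[i][k] /= A[k][k]\<close>\<close>
  | Diag_final nat            \<comment> \<open>\<open>A[k][k] = (A[k][k] > 0) ? (-norma) : (norma)\<close>\<close>
  | Tau_init nat nat          \<comment> \<open>\<open>tau[j] = A[k][j]\<close>\<close>
  | Tau_add nat nat nat       \<comment> \<open>\<open>tau[j] += A[i][k]*A[i][j]\<close>\<close>
  | Tau_scale nat nat         \<comment> \<open>\<open>tau[j] = tau[k]*tau[j]\<close>\<close>
  | Row_update nat nat        \<comment> \<open>\<open>A[k][j] = A[k][j] - tau[j]\<close>\<close>
  | Mat_update nat nat nat    \<comment> \<open>\<open>A[i][j] = A[i][j] - A[i][k]*tau[j]\<close>\<close>

fun writes :: "stmt \<Rightarrow> loc" where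
  "writes (Norma2_zero k) = LNorma2"
| "writes (Norma2_add k i) = LNorma2"
| "writes (Norma_sqrt k) = LNorma"
| "writes (Diag_shift k) = LA k k"
| "writes (Tau_diag k) = LTau k"
| "writes (Col_scale k i) = LA i k"
| "writes (Diag_final k) = LA k k"
| "writes (Tau_init k j) = LTau j"
| "writes (Tau_add k j i) = LTau j"
| "writes (Tau_scale k j) = LTau j"
| "writes (Row_update k j) = LA k j"
| "writes (Mat_update k j i) = LA i j"

fun reads :: "stmt \<Rightarrow> loc set" where
  "reads (Norma2_zero k) = {}"
| "reads (Norma2_add k i) = {LNorma2, LA i k}"
| "reads (Norma_sqrt k) = {LA k k, LNorma2}"
| "reads (Diag_shift k) = {LA k k, LNorma}"
| "reads (Tau_diag k) = {LNorma2, LA k k}"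
| "reads (Col_scale k i) = {LA i k, LA k k}"
| "reads (Diag_final k) = {LA k k, LNorma}"
| "reads (Tau_init k j) = {LA k j}"
| "reads (Tau_add k j i) = {LTau j, LA i k, LA i j}"
| "reads (Tau_scale k j) = {LTau k, LTau j}"
| "reads (Row_update k j) = {LA k j, LTau j}"
| "reads (Mat_update k j i) = {LA i j, LA i k, LTau j}"

definition householder_col :: "nat \<Rightarrow> nat \<Rightarrow> nat \<Rightarrow> stmt list" where
  "householder_col M k j =
     [Tau_init k j]
     @ map (Tau_add k j) [k+1..<M]
     @ [Tau_scale k j, Row_update k j]
     @ map (Mat_update k j) [k+1..<M]"

definition householder_iter :: "nat \<Rightarrow> nat \<Rightarrow> nat \<Rightarrow> stmt list" where
  "householder_iter M N k =
     [Norma2_zero k]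
     @ map (Norma2_add k) [k+1..<M]
     @ [Norma_sqrt k, Diag_shift k, Tau_diag k]
     @ map (Col_scale k) [k+1..<M]
     @ [Diag_final k]
     @ concat (map (householder_col M k) [k+1..<N])"

definition householder_trace :: "nat \<Rightarrow> nat \<Rightarrow> stmt list" where
  "householder_trace M N = concat (map (householder_iter M N) [0..<N])"

definition householder_cdag :: "nat \<Rightarrow> nat \<Rightarrow> (loc, stmt) cdag" where
  "householder_cdag M N = cdag_of writes reads (householder_trace M N)"

text \<open>Identifying statement instances with elements of \<open>stmt\<close> is justified by:\<close>

lemma distinct_concat_map:
  assumes "distinct xs" "\<And>x. x \<in> set xs \<Longrightarrow> distinct (f x)"
    "\<And>x y. x \<in> set xs \<Longrightarrow> y \<in> set xs \<Longrightarrow> x \<noteq> y \<Longrightarrow> set (f x) \<inter> set (f y) = {}"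
  shows "distinct (concat (map f xs))"
  using assms by (induction xs) fastforce+

lemma distinct_householder_trace: "distinct (householder_trace M N)"
proof -
  have col: "distinct (householder_col M k j)" for k j
    by (auto simp: householder_col_def distinct_map inj_on_def)
  have cols: "distinct (concat (map (householder_col M k) [k+1..<N]))" for k
    by (rule distinct_concat_map[OF _ col]) (auto simp: householder_col_def)
  have iter: "distinct (householder_iter M N k)" for k
    unfolding householder_iter_def using cols[of k]
    by (auto simp: distinct_map inj_on_def householder_col_def)
  show ?thesis unfolding householder_trace_def
    by (rule distinct_concat_map[OF _ iter])
      (auto simp: householder_iter_def householder_col_def)
qed

end

theory Submission imports Defs
begin

text \<open>
  Every node is first pebbled red at some moment, and these moments increase along edges. Consider
  the versions of the matrix entries (the initial one and one for each \<open>Mat_update\<close>), and cut the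
  game into segments of \<open>S\<close> loads. A segment touches at most \<open>K = 2 * S\<close> matrix locations, namely
  those of the pebbles present at its start and of its loads. If column \<open>j\<close> is advanced in the
  segment from level \<open>k1\<close> to level \<open>k2\<close>, then, since \<open>tau[j]\<close> depends on all rows of a level and
  is needed by all rows of the next one, all levels strictly between are computed completely within
  the segment (the hourglass pattern). Each of these uses at least \<open>M - N\<close> rows of two columns. Hence
  a segment acquires at most \<open>M * K\<^sup>2 / (M - N)\<^sup>2 + 2 * K\<close> versions. Counting the
  inputs as versions makes up for the difference between the number of updates and
  \<open>N\<^sup>2 * (3 * M - N) / 6\<close>.
\<close>

section \<open>Paths in the CDAG of a trace\<close>

fun node_loc :: "('s \<Rightarrow> 'l) \<Rightarrow> ('l, 's) node \<Rightarrow> 'l" where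
  "node_loc wr (Input l) = l"
| "node_loc wr (Inst s) = wr s"

lemma nodes_cdag_of: "Inst s \<in> nodes (cdag_of wr rd t) \<longleftrightarrow> s \<in> set t"
  by (auto simp: cdag_of_def Let_def)

lemma inputs_cdag_of: "Inst s \<notin> inputs (cdag_of wr rd t)"
  by (auto simp: cdag_of_def Let_def)

lemma edges_cdag_of_target:
  assumes "(u, v) \<in> edges (cdag_of wr rd t)"
  obtains s where "v = Inst s" "s \<in> set t"
proof -
  have "\<exists>s. v = Inst s \<and> s \<in> set t"
    using assms by (auto simp: cdag_of_def Let_def reads_initial_def flow_dep_def)
  then show ?thesis using that by blast
qed

lemma last_writer:
  assumes "q < length t" "l \<in> rd (t ! q)" "r < q" "wr (t ! r) = l"
  obtains p where "r \<le> p" "p < q" "wr (t ! p) = l"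
    "(Inst (t ! p), Inst (t ! q)) \<in> edges (cdag_of wr rd t)"
proof -
  define p where "p = Max {r. r < q \<and> wr (t ! r) = l}"
  have fin: "finite {r. r < q \<and> wr (t ! r) = l}" by simp
  have "p \<in> {r. r < q \<and> wr (t ! r) = l}"
    unfolding p_def using assms by (intro Max_in fin) auto
  moreover have "r' \<le> p" if "r' < q" "wr (t ! r') = l" for r'
    unfolding p_def using that by (intro Max_ge fin) auto
  ultimately have p: "p < q" "wr (t ! p) = l" "r \<le> p"
    and "flow_dep wr rd t p q"
    using assms by (fastforce simp: flow_dep_def)+
  then show ?thesis
    by (intro that[of p]) (auto simp: cdag_of_def Let_def)
qed

lemma initial_edge:
  assumes "q < length t" "l \<in> rd (t ! q)" "\<forall>r<q. wr (t ! r) \<noteq> l"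
  shows "(Input l, Inst (t ! q)) \<in> edges (cdag_of wr rd t)"
  using assms by (auto simp: cdag_of_def Let_def reads_initial_def)

lemma read_has_pred:
  assumes "s \<in> set t" "l \<in> rd s"
  obtains u where "(u, Inst s) \<in> edges (cdag_of wr rd t)" "node_loc wr u = l"
proof -
  obtain q where q: "q < length t" "s = t ! q" using assms by (auto simp: in_set_conv_nth)
  show ?thesis
  proof (cases "\<exists>r<q. wr (t ! r) = l")
    case True
    then obtain r where "r < q" "wr (t ! r) = l" by blast
    then show ?thesis
      using last_writer[of q t l rd r wr] q assms that by (metis node_loc.simps(2))
  next
    case False
    then show ?thesis
      using initial_edge[of q t l rd wr] q assms that by (metis node_loc.simps(1))
  qed
qed

text \<open>Follow the reads of \<open>l\<close> backwards from \<open>q\<close>: each leads to the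
  last earlier writer of \<open>l\<close>, which lies at or after \<open>p\<close> and, unless it is
  \<open>p\<close>, reads \<open>l\<close> itself. The chain therefore cannot jump over
  \<open>p\<close>.\<close>

lemma write_read_path_nth:
  assumes "p < q" "q < length t" "l \<in> rd (t ! q)" "wr (t ! p) = l"
    and "\<And>r. p < r \<Longrightarrow> r < q \<Longrightarrow> wr (t ! r) = l \<Longrightarrow> l \<in> rd (t ! r)"
  shows "(Inst (t ! p), Inst (t ! q)) \<in> (edges (cdag_of wr rd t))\<^sup>+"
  using assms
proof (induction q rule: less_induct)
  case (less q)
  obtain r where r: "p \<le> r" "r < q" "wr (t ! r) = l"
    "(Inst (t ! r), Inst (t ! q)) \<in> edges (cdag_of wr rd t)"
    using last_writer[of q t l rd p wr] less.prems by blast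
  show ?case
  proof (cases "r = p")
    case True
    then show ?thesis using r by blast
  next
    case False
    then have "(Inst (t ! p), Inst (t ! r)) \<in> (edges (cdag_of wr rd t))\<^sup>+"
      using r less.prems by (intro less.IH) auto
    then show ?thesis using r by (meson trancl_into_trancl)
  qed
qed

text \<open>The in-place condition is asked only of the instances in between, so that it also fits
  \<open>tau[j]\<close>, which \<open>Tau_init\<close> overwrites without reading it.\<close>

lemma write_read_path:
  assumes "t = xs @ x # ys @ y # zs" "l \<in> rd y" "wr x = l"
    and "\<And>s. s \<in> set ys \<Longrightarrow> wr s = l \<Longrightarrow> l \<in> rd s"
  shows "(Inst x, Inst y) \<in> (edges (cdag_of wr rd t))\<^sup>+"
proof -
  let ?p = "length xs" and ?q = "length xs + Suc (length ys)"
  have tp: "t ! ?p = x" and tq: "t ! ?q = y"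
    using assms(1) by (auto simp: nth_append)
  have mid: "t ! r \<in> set ys" if "?p < r" "r < ?q" for r
    using that assms(1) by (auto simp: nth_append nth_Cons' )
  have "(Inst (t ! ?p), Inst (t ! ?q)) \<in> (edges (cdag_of wr rd t))\<^sup>+"
    using assms mid tp tq by (intro write_read_path_nth[where l = l]) auto
  then show ?thesis using tp tq by simp
qed

text \<open>The same backward chain: as every writer of \<open>l\<close> reads \<open>l\<close>, it
  can end only at the initial content.\<close>

lemma input_read_path:
  assumes "y \<in> set t" "l \<in> rd y" and "\<And>s. wr s = l \<Longrightarrow> l \<in> rd s"
  shows "(Input l, Inst y) \<in> (edges (cdag_of wr rd t))\<^sup>+"
proof -
  have "(Input l, Inst (t ! q)) \<in> (edges (cdag_of wr rd t))\<^sup>+"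
    if "q < length t" "l \<in> rd (t ! q)" for q
    using that
  proof (induction q rule: less_induct)
    case (less q)
    show ?case
    proof (cases "\<exists>r<q. wr (t ! r) = l")
      case True
      then obtain r where "r < q" "wr (t ! r) = l" by blast
      then obtain p where p: "p < q" "wr (t ! p) = l"
        "(Inst (t ! p), Inst (t ! q)) \<in> edges (cdag_of wr rd t)"
        using last_writer[of q t l rd r wr] less.prems by blast
      then have "(Input l, Inst (t ! p)) \<in> (edges (cdag_of wr rd t))\<^sup>+"
        using less assms(3) by (intro less.IH) auto
      then show ?thesis using p by (meson trancl_into_trancl)
    next
      case False
      then show ?thesis using initial_edge[of q t l rd wr] less.prems by blast
    qed
  qed
  then show ?thesis using assms by (auto simp: in_set_conv_nth)
qed

lemma append_write_read_path:
  assumes "t = xs @ ys" "x \<in> set xs" "y \<in> set ys" "l \<in> rd y" "wr x = l"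
    and "\<And>s. wr s = l \<Longrightarrow> l \<in> rd s"
  shows "(Inst x, Inst y) \<in> (edges (cdag_of wr rd t))\<^sup>+"
proof -
  obtain a b where "xs = a @ x # b" using assms(2) by (meson split_list)
  moreover obtain c d where "ys = c @ y # d" using assms(3) by (meson split_list)
  ultimately have "t = a @ x # (b @ c) @ y # d" using assms(1) by simp
  then show ?thesis by (rule write_read_path) (use assms in auto)
qed

section \<open>Pebble games\<close>

fun red_step :: "'v move \<Rightarrow> 'v set \<Rightarrow> 'v set" where
  "red_step (Spill v) R = R - {v}"
| "red_step (Compute v) R = insert v R"
| "red_step (Load v) R = insert v R"

fun white_step :: "'v move \<Rightarrow> 'v set \<Rightarrow> 'v set" where
  "white_step (Compute v) W = insert v W"
| "white_step _ W = W"

definition red_after :: "'v move list \<Rightarrow> 'v set" where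
  "red_after ms = fold red_step ms {}"

definition white_after :: "'v set \<Rightarrow> 'v move list \<Rightarrow> 'v set" where
  "white_after I ms = fold white_step ms I"

text \<open>The bound on the number of red pebbles concerns positions and is stated separately in
  \<open>plays_positions\<close>.\<close>

fun legal :: "('l, 's) cdag \<Rightarrow> ('l, 's) node move \<Rightarrow> ('l, 's) node set \<Rightarrow> ('l, 's) node set \<Rightarrow> bool" where
  "legal G (Spill v) R W \<longleftrightarrow> True"
| "legal G (Compute v) R W \<longleftrightarrow> v \<in> nodes G \<and> v \<notin> W \<and> preds G v \<subseteq> R"
| "legal G (Load v) R W \<longleftrightarrow> v \<in> W"

lemma red_after_snoc [simp]: "red_after (ms @ [m]) = red_step m (red_after ms)"
  by (simp add: red_after_def)

lemma white_after_snoc [simp]: "white_after I (ms @ [m]) = white_step m (white_after I ms)"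
  by (simp add: white_after_def)

lemma finite_red_after: "finite (red_after ms)"
proof (induction ms rule: rev_induct)
  case (snoc m ms)
  then show ?case by (cases m) auto
qed (simp add: red_after_def)

lemma plays_positions:
  assumes "plays G S ms R W"
  shows "R = red_after ms \<and> W = white_after (inputs G) ms \<and> card R \<le> S \<and>
    (\<forall>t<length ms. legal G (ms ! t) (red_after (take t ms)) (white_after (inputs G) (take t ms))
       \<and> card (red_after (take t ms)) \<le> S)"
  using assms
proof induction
  case start
  then show ?case by (simp add: red_after_def white_after_def)
next
  case (spill ms R W v)
  then have "card (R - {v}) \<le> S" by (meson card_Diff1_le le_trans)
  with spill show ?case by (auto simp: nth_append less_Suc_eq)
next
  case (compute ms R W v)
  then show ?case by (auto simp: nth_append less_Suc_eq)
next
  case (load ms R W v)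
  then show ?case by (auto simp: nth_append less_Suc_eq)
qed

locale pebble_game =
  fixes wr :: "'s \<Rightarrow> 'l" and rd :: "'s \<Rightarrow> 'l set" and tr :: "'s list"
    and S :: nat and ms :: "('l, 's) node move list"
  assumes complete: "complete_game (cdag_of wr rd tr) S ms"
begin

abbreviation "G \<equiv> cdag_of wr rd tr"

definition red :: "nat \<Rightarrow> ('l, 's) node set" where
  "red t = red_after (take t ms)"

definition white :: "nat \<Rightarrow> ('l, 's) node set" where
  "white t = white_after (inputs G) (take t ms)"

definition loads :: "nat \<Rightarrow> nat" where
  "loads t = num_loads (take t ms)"

definition loaded :: "nat \<Rightarrow> nat \<Rightarrow> ('l, 's) node set" where
  "loaded a b = {v. \<exists>t\<in>{a..<b}. t < length ms \<and> ms ! t = Load v}"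

text \<open>Moments number positions, not moves: the move with index \<open>t\<close> leads to
  moment \<open>Suc t\<close>. An input counts from its first load, not from the start. For a node
  that is never red the value carries no information, hence \<open>acquired\<close>.\<close>

definition first :: "('l, 's) node \<Rightarrow> nat" where
  "first v = (LEAST t. v \<in> red t)"

definition acquired :: "('l, 's) node \<Rightarrow> bool" where
  "acquired v \<longleftrightarrow> (\<exists>t. v \<in> red t)"

lemma red_0 [simp]: "red 0 = {}" and white_0 [simp]: "white 0 = inputs G"
  and loads_0 [simp]: "loads 0 = 0"
  by (auto simp: red_def white_def loads_def red_after_def white_after_def num_loads_def)

lemma red_Suc: "t < length ms \<Longrightarrow> red (Suc t) = red_step (ms ! t) (red t)"
  and white_Suc: "t < length ms \<Longrightarrow> white (Suc t) = white_step (ms ! t) (white t)"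
  by (auto simp: red_def white_def take_Suc_conv_app_nth)

lemma red_stable: "length ms \<le> t \<Longrightarrow> red t = red (length ms)"
  and white_stable: "length ms \<le> t \<Longrightarrow> white t = white (length ms)"
  by (auto simp: red_def white_def)

lemma loads_Suc:
  "loads (Suc t) = loads t + (if t < length ms \<and> (\<exists>v. ms ! t = Load v) then 1 else 0)"
  by (cases "t < length ms") (auto simp: loads_def num_loads_def take_Suc_conv_app_nth)

lemma loads_length: "loads (length ms) = num_loads ms"
  by (simp add: loads_def)

lemma finite_red: "finite (red t)"
  by (simp add: red_def finite_red_after)

lemma positions:
  shows legal: "t < length ms \<Longrightarrow> legal G (ms ! t) (red t) (white t)"
    and card_red: "card (red t) \<le> S"
    and nodes_white: "nodes G \<subseteq> white (length ms)"
proof -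
  obtain R W where p: "plays G S ms R W" "nodes G \<subseteq> W"
    using complete by (auto simp: complete_game_def)
  note q = plays_positions[OF p(1)]
  show "t < length ms \<Longrightarrow> legal G (ms ! t) (red t) (white t)"
    using q by (simp add: red_def white_def)
  show "nodes G \<subseteq> white (length ms)"
    using q p by (simp add: white_def)
  show "card (red t) \<le> S"
    using q by (cases "t < length ms") (auto simp: red_def)
qed

lemma inputs_white: "inputs G \<subseteq> white t"
proof (induction t)
  case (Suc t)
  then show ?case
    by (cases "t < length ms"; cases "ms ! t")
      (auto simp: white_Suc white_stable[of "Suc t"] white_stable[of t])
qed simp

text \<open>Only a compute move whitens a node, and it makes the node red at the same
  moment.\<close>

lemma white_red_before: "v \<in> white t \<Longrightarrow> v \<notin> inputs G \<Longrightarrow> \<exists>t'\<le>t. v \<in> red t'"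
proof (induction t)
  case (Suc t)
  show ?case
  proof (cases "v \<in> white t")
    case True
    then show ?thesis using Suc by (meson le_SucI)
  next
    case False
    then have t: "t < length ms"
      using Suc.prems by (metis not_le white_stable le_SucI)
    then have "ms ! t = Compute v"
      using False Suc.prems by (cases "ms ! t") (auto simp: white_Suc)
    then have "v \<in> red (Suc t)" using t by (simp add: red_Suc)
    then show ?thesis by blast
  qed
qed simp

lemma acquired_instance:
  assumes "s \<in> set tr"
  shows "acquired (Inst s)"
proof -
  have "Inst s \<in> white (length ms)"
    using nodes_white assms nodes_cdag_of[of s wr rd tr] by blast
  then show ?thesis
    using white_red_before[of "Inst s" "length ms"] inputs_cdag_of[of s wr rd tr]
    unfolding acquired_def by blast
qed

lemma first_Suc:
  assumes "acquired v"
  obtains t where "first v = Suc t" "v \<in> red (Suc t)" "v \<notin> red t" "t < length ms"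
    "\<And>t'. t' \<le> t \<Longrightarrow> v \<notin> red t'"
proof -
  have *: "v \<in> red (first v)"
    using assms unfolding acquired_def first_def by (rule LeastI_ex)
  then obtain t where t: "first v = Suc t" by (cases "first v") auto
  have before: "v \<notin> red t'" if "t' \<le> t" for t'
    using that t not_less_Least[of t' "\<lambda>t. v \<in> red t"] unfolding first_def by auto
  moreover have "t < length ms"
    using * before t by (metis not_le order_refl red_stable le_SucI)
  ultimately show ?thesis using * t that by simp
qed

lemma first_le: "v \<in> red t \<Longrightarrow> first v \<le> t"
  unfolding first_def by (rule Least_le)

text \<open>The first red pebble on an instance cannot come from a load: loading needs a white
  pebble, which a non-input node receives only together with an earlier red one.\<close>

lemma first_compute:
  assumes "s \<in> set tr"
  obtains t where "first (Inst s) = Suc t" "preds G (Inst s) \<subseteq> red t"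
proof -
  obtain t where t: "first (Inst s) = Suc t" "Inst s \<in> red (Suc t)" "Inst s \<notin> red t" "t < length ms"
    and before: "\<And>t'. t' \<le> t \<Longrightarrow> Inst s \<notin> red t'"
    using first_Suc[OF acquired_instance[OF assms]] by blast
  have l: "legal G (ms ! t) (red t) (white t)" using t(4) by (rule legal)
  have "ms ! t = Compute (Inst s) \<or> ms ! t = Load (Inst s)"
    using t red_Suc[of t] by (cases "ms ! t") auto
  moreover have "ms ! t \<noteq> Load (Inst s)"
    using l before white_red_before[of "Inst s" t] inputs_cdag_of by fastforce
  ultimately show ?thesis using that t l by auto
qed

lemma edge_first:
  assumes "(u, v) \<in> edges G"
  shows "acquired u \<and> acquired v \<and> first u < first v"
proof -
  obtain s where s: "v = Inst s" "s \<in> set tr" using assms by (rule edges_cdag_of_target)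
  obtain t where "first v = Suc t" "preds G v \<subseteq> red t" using first_compute s by blast
  moreover from this have "u \<in> red t" using assms by (auto simp: preds_def)
  ultimately show ?thesis
    using s acquired_instance first_le[of u t] by (auto simp: acquired_def)
qed

lemma path_first:
  assumes "(u, v) \<in> (edges G)\<^sup>+"
  shows "acquired u \<and> acquired v \<and> first u < first v"
  using assms by (induction rule: trancl.induct) (use edge_first less_trans in blast)+

section \<open>Locations touched between two moments\<close>

lemma card_loaded: "a \<le> b \<Longrightarrow> finite (loaded a b) \<and> loads a + card (loaded a b) \<le> loads b"
proof (induction b rule: dec_induct)
  case base
  then show ?case by (simp add: loaded_def)
next
  case (step n)
  have range: "{a..<Suc n} = insert n {a..<n}" using step.hyps by auto
  show ?case
  proof (cases "n < length ms \<and> (\<exists>v. ms ! n = Load v)")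
    case True
    then obtain v where "n < length ms" "ms ! n = Load v" by blast
    then have "loaded a (Suc n) = insert v (loaded a n)"
      unfolding loaded_def range by auto
    then show ?thesis
      using step.IH True by (auto simp: loads_Suc card_insert_if)
  next
    case False
    then have "loaded a (Suc n) = loaded a n"
      unfolding loaded_def range by auto
    then show ?thesis using step.IH False by (auto simp: loads_Suc)
  qed
qed

definition touched :: "nat \<Rightarrow> nat \<Rightarrow> 'l set" where
  "touched a b = node_loc wr ` (red a \<union> loaded a b)"

lemma card_touched:
  assumes "a \<le> b"
  shows "finite (touched a b)" "card (touched a b) \<le> card (red a) + (loads b - loads a)"
proof -
  note L = card_loaded[OF assms]
  show "finite (touched a b)" using L by (simp add: touched_def finite_red)
  have "card (touched a b) \<le> card (red a \<union> loaded a b)"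
    unfolding touched_def using L by (intro card_image_le) (simp add: finite_red)
  also have "\<dots> \<le> card (red a) + card (loaded a b)" by (rule card_Un_le)
  finally show "card (touched a b) \<le> card (red a) + (loads b - loads a)" using L by linarith
qed

text \<open>
  A value of a location that is only ever updated in place can be computed only from an
  older value of that location, so some version of it must come from outside the segment.
\<close>

lemma red_touched:
  assumes "a \<le> t" "t \<le> b" "v \<in> red t" "node_loc wr v = l" "\<And>s. wr s = l \<Longrightarrow> l \<in> rd s"
  shows "l \<in> touched a b"
  using assms(1-4)
proof (induction t arbitrary: v rule: dec_induct)
  case base
  then show ?case by (auto simp: touched_def)
next
  case (step t)
  show ?case
  proof (cases "v \<in> red t")
    case True
    then show ?thesis using step by auto
  next
    case new: False
    then have t: "t < length ms"
      using step.prems by (metis not_le red_stable le_SucI)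
    then have "ms ! t = Compute v \<or> ms ! t = Load v"
      using new step.prems red_Suc[OF t] by (cases "ms ! t") auto
    then show ?thesis
    proof
      assume "ms ! t = Load v"
      then have "v \<in> loaded a b" using t step by (auto simp: loaded_def)
      then show ?thesis using step.prems by (auto simp: touched_def)
    next
      assume "ms ! t = Compute v"
      then have v: "v \<in> nodes G" "v \<notin> white t" "preds G v \<subseteq> red t"
        using legal[OF t] by auto
      then have "v \<notin> inputs G" using inputs_white by blast
      then obtain s where s: "v = Inst s" "s \<in> set tr"
        using v(1) by (auto simp: cdag_of_def Let_def)
      then have "l \<in> rd s" using step.prems assms(5) by auto
      then obtain u where "(u, Inst s) \<in> edges G" "node_loc wr u = l"
        using read_has_pred s by metis
      then show ?thesis using step v s by (auto simp: preds_def)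
    qed
  qed
qed

text \<open>
  The first segment starts without red pebbles and can therefore be given \<open>2 * S\<close> loads;
  this compensates for the incomplete last segment.
\<close>

lemma loads_lower_bound:
  fixes U :: "nat \<Rightarrow> real" and X :: "('l, 's) node set"
  assumes "finite X" "\<And>v. v \<in> X \<Longrightarrow> acquired v" "S > 0" and mono: "mono U"
    and seg: "\<And>a b. a \<le> b \<Longrightarrow>
      real (card {v \<in> X. a < first v \<and> first v \<le> b}) \<le> U (card (red a) + (loads b - loads a))"
  obtains "num_loads ms < 2 * S" "real (card X) \<le> U (num_loads ms)"
  | "2 * S \<le> num_loads ms" "real S * real (card X) \<le> real (num_loads ms) * U (2 * S)"
proof -
  let ?Q = "num_loads ms"
  define f where "f t = card {v \<in> X. first v \<le> t}" for t
  have start: "real (f t) \<le> U (loads t)" for t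
  proof -
    have "0 < first v" if "v \<in> X" for v
      using first_Suc[OF assms(2)[OF that]] by (metis zero_less_Suc)
    then have "{v \<in> X. first v \<le> t} = {v \<in> X. 0 < first v \<and> first v \<le> t}" by auto
    then show ?thesis using seg[of 0 t] by (simp add: f_def)
  qed
  \<comment> \<open>There are at most \<open>S\<close> red pebbles at moment \<open>a\<close> and at
    most \<open>S\<close> loads afterwards.\<close>
  have step: "real (f b) \<le> real (f a) + U (2 * S)" if "a \<le> b" "loads b \<le> loads a + S" for a b
  proof -
    have "{v \<in> X. first v \<le> b} = {v \<in> X. first v \<le> a} \<union> {v \<in> X. a < first v \<and> first v \<le> b}"
      using that by auto
    then have "f b \<le> f a + card {v \<in> X. a < first v \<and> first v \<le> b}"
      unfolding f_def by (simp add: card_Un_le)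
    moreover have "U (card (red a) + (loads b - loads a)) \<le> U (2 * S)"
      using card_red[of a] that by (intro monoD[OF mono]) linarith
    ultimately show ?thesis using seg[OF that(1)] by linarith
  qed
  have U_nonneg: "0 \<le> U (2 * S)"
    using start[of 0] monoD[OF mono, of 0 "2 * S"] by simp
  \<comment> \<open>One opening segment of \<open>2 * S\<close> loads is followed by
    \<open>g\<close> segments of \<open>S\<close> loads each.\<close>
  have segs: "real (f t) \<le> real (Suc g) * U (2 * S)" if "loads t \<le> (g + 2) * S" for g t
    using that
  proof (induction g arbitrary: t)
    case 0
    then have "U (loads t) \<le> U (2 * S)" by (intro monoD[OF mono]) simp
    then show ?case using start[of t] by simp
  next
    case (Suc g)
    \<comment> \<open>The last moment up to \<open>t\<close> within the load budget. Unless it is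
      \<open>t\<close>, the next move exceeds the budget; since a move adds at most one load, the
      budget is then used up exactly at \<open>a\<close>.\<close>
    define a where "a = Max {s. s \<le> t \<and> loads s \<le> (g + 2) * S}"
    have fin: "finite {s. s \<le> t \<and> loads s \<le> (g + 2) * S}" by simp
    have "a \<in> {s. s \<le> t \<and> loads s \<le> (g + 2) * S}"
      unfolding a_def by (intro Max_in fin) (auto intro: exI[of _ 0])
    then have a: "a \<le> t" "loads a \<le> (g + 2) * S" by auto
    have "loads t \<le> loads a + S"
    proof (cases "a = t")
      case False
      then have "Suc a \<le> a" if "loads (Suc a) \<le> (g + 2) * S"
        using a that Max_ge[OF fin, of "Suc a"] unfolding a_def[symmetric] by simp
      then have "\<not> loads (Suc a) \<le> (g + 2) * S" by fastforce
      then have "(g + 2) * S \<le> loads a" by (simp add: loads_Suc split: if_splits)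
      then show ?thesis using Suc.prems by (simp add: algebra_simps)
    qed simp
    then have "real (f t) \<le> real (f a) + U (2 * S)" using a step by blast
    then show ?case using Suc.IH[OF a(2)] by (simp add: algebra_simps)
  qed
  have "first v \<le> length ms" if "v \<in> X" for v
    using first_Suc[OF assms(2)[OF that]] by (metis Suc_leI)
  then have X: "f (length ms) = card X" by (auto simp: f_def intro: arg_cong[of _ _ card])
  show ?thesis
  proof (cases "?Q < 2 * S")
    case True
    then show ?thesis using that(1) start[of "length ms"] X by (simp add: loads_length)
  next
    case False
    \<comment> \<open>As \<open>g + 2 = q + 1\<close>, the \<open>q\<close> segments have room for
      \<open>(q + 1) * S\<close> loads, which covers \<open>?Q\<close>; conversely
      \<open>q * S\<close> is at most \<open>?Q\<close>, so nothing is lost to the incomplete last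
      segment.\<close>
    define q where "q = ?Q div S"
    have q: "q * S \<le> ?Q" "?Q \<le> (q + 1) * S"
      using assms(3) by (auto simp: q_def algebra_simps dividend_less_times_div less_imp_le)
    have "q \<ge> 2" using False assms(3) by (simp add: q_def less_eq_div_iff_mult_less_eq)
    then obtain g where g: "q = Suc g" by (cases q) auto
    have "real (card X) \<le> real q * U (2 * S)"
      using segs[of "length ms" g] q g X by (simp add: loads_length)
    then have "real S * real (card X) \<le> real (q * S) * U (2 * S)"
      using assms(3) by (simp add: algebra_simps mult_left_mono)
    also have "\<dots> \<le> real ?Q * U (2 * S)"
      using q U_nonneg by (intro mult_right_mono) (simp_all only: of_nat_le_iff)
    finally show ?thesis using that(2) False by simp
  qed
qed

end

section \<open>The hourglass bound\<close>

text \<open>A triple is a level, a column and a row. Level 0 stands for the initial entry, level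
  \<open>k > 0\<close> for its value after update \<open>k - 1\<close>, which reaches only columns
  and rows with index at least \<open>k\<close>.\<close>

definition version_indices :: "nat \<Rightarrow> nat \<Rightarrow> (nat \<times> nat \<times> nat) set" where
  "version_indices M N = {(k, j, i). k \<le> j \<and> k \<le> i \<and> j < N \<and> i < M}"

lemma finite_version_indices: "finite (version_indices M N)"
  by (rule finite_subset[of _ "{..N} \<times> {..N} \<times> {..M}"]) (auto simp: version_indices_def)

lemma sum_products:
  "N \<le> M \<Longrightarrow> 6 * (\<Sum>k<N. (real N - real k) * (real M - real k))
    = real N * (real N + 1) * (3 * real M - real N + 1)"
proof -
  assume "N \<le> M"
  \<comment> \<open>The induction needs \<open>c\<close> and \<open>d\<close> to stay fixed while
    the upper limit varies.\<close>
  have "6 * (\<Sum>k<n. (c - real k) * (d - real k))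
      = real n * (6 * c * d - 3 * (c + d) * (real n - 1) + (real n - 1) * (2 * real n - 1))" for n c d
    by (induction n) (auto simp: algebra_simps)
  from this[where n = N and c = "real N" and d = "real M"] show ?thesis
    by (simp add: algebra_simps)
qed

lemma card_version_indices:
  assumes "N \<le> M"
  shows "6 * real (card (version_indices M N)) = real N * (real N + 1) * (3 * real M - real N + 1)"
proof -
  have "version_indices M N = (SIGMA k:{..<N}. {k..<N} \<times> {k..<M})"
    by (auto simp: version_indices_def)
  then have "card (version_indices M N) = (\<Sum>k<N. (N - k) * (M - k))"
    by (simp add: card_cartesian_product)
  then have "real (card (version_indices M N)) = (\<Sum>k<N. (real N - real k) * (real M - real k))"
    using assms by (simp add: of_nat_diff)
  then show ?thesis using sum_products[OF assms] by simp
qed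

text \<open>Double counting: the parts of \<open>T\<close> in different columns are disjoint. With
  \<open>D = 0\<close> every column would be heavy, so positivity is what gives finiteness.\<close>

lemma card_heavy_columns:
  fixes T :: "(nat \<times> nat) set"
  assumes "finite T" "D > 0"
  defines "C \<equiv> {c. D \<le> card {i. (i, c) \<in> T}}"
  shows "finite C" "card C * D \<le> card T"
proof -
  have ne: "{i. (i, c) \<in> T} \<noteq> {}" if "c \<in> C" for c
    using that assms(2) unfolding C_def by (metis (mono_tags) card.empty leD mem_Collect_eq)
  have "C \<subseteq> snd ` T" using ne by force
  then show fin: "finite C" using assms(1) finite_subset by blast
  have fi: "finite {i. (i, c) \<in> T}" for c
    by (rule finite_subset[of _ "fst ` T"]) (use assms(1) in force)+
  have "card C * D \<le> (\<Sum>c\<in>C. card {i. (i, c) \<in> T})"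
    using sum_bounded_below[of C D "\<lambda>c. card {i. (i, c) \<in> T}"] by (simp add: C_def)
  also have "\<dots> = card (SIGMA c:C. {i. (i, c) \<in> T})"
    using fin fi by (subst card_SigmaI) auto
  also have "\<dots> = card ((\<lambda>(c, i). (i, c)) ` (SIGMA c:C. {i. (i, c) \<in> T}))"
    by (subst card_image) (auto simp: inj_on_def)
  also have "\<dots> \<le> card T"
    by (intro card_mono assms(1)) auto
  finally show "card C * D \<le> card T" .
qed

text \<open>
  For each column, the entries in its lowest and highest level are charged to \<open>T\<close>. All levels
  strictly in between are complete, so they only involve columns with at least \<open>M - N\<close> entries
  in \<open>T\<close>, of which there are at most \<open>card T / (M - N)\<close>.
\<close>

lemma hourglass_bound:
  fixes T :: "(nat \<times> nat) set"
  assumes "N < M" "E \<subseteq> version_indices M N" "finite T"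
    and own: "\<And>k j i. (k, j, i) \<in> E \<Longrightarrow> (i, j) \<in> T"
    and pivot: "\<And>k j i. (Suc k, j, i) \<in> E \<Longrightarrow> (i, k) \<in> T"
    and convex: "\<And>j k1 i1 k i k2 i2. (k1, j, i1) \<in> E \<Longrightarrow> (k2, j, i2) \<in> E \<Longrightarrow> k1 < k \<Longrightarrow> k < k2 \<Longrightarrow>
      (k, j, i) \<in> version_indices M N \<Longrightarrow> (k, j, i) \<in> E"
  shows "(M - N)\<^sup>2 * card E \<le> M * (card T)\<^sup>2 + 2 * (M - N)\<^sup>2 * card T"
proof -
  let ?D = "M - N"
  have finE: "finite E" using assms(2) finite_version_indices finite_subset by blast
  define lev where "lev j = {k. \<exists>i. (k, j, i) \<in> E}" for j
  have fin_lev: "finite (lev j)" for j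
    by (rule finite_subset[of _ "fst ` E"]) (use finE in \<open>force simp: lev_def\<close>)+
  \<comment> \<open>Used with \<open>Min\<close> and \<open>Max\<close> for \<open>m\<close>: only
    one level is attached to each column, so there are no more triples than entries of
    \<open>T\<close>.\<close>
  define F where "F m = (\<lambda>(i, j). (m (lev j), j, i)) ` T" for m :: "nat set \<Rightarrow> nat"
  have card_F: "card (F m) \<le> card T" "finite (F m)" for m
    unfolding F_def using assms(3) by (auto intro: card_image_le)
  define C where "C = {c. ?D \<le> card {i. (i, c) \<in> T}}"
  have C: "finite C" "card C * ?D \<le> card T"
    using card_heavy_columns[OF assms(3), of ?D] assms(1) by (auto simp: C_def)
  \<comment> \<open>An interior version is determined by its pivot column, its own column and its
    row. Both columns will turn out to be heavy.\<close>
  define W where "W = (\<lambda>(k, j, i). (Suc k, j, i)) ` (C \<times> C \<times> {..<M})"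
  have card_W: "card W \<le> M * (card C)\<^sup>2" "finite W"
    unfolding W_def using C(1)
    by (auto intro!: order.trans[OF card_image_le] simp: card_cartesian_product power2_eq_square)
  \<comment> \<open>The rows from \<open>k\<close> on are \<open>M - k\<close> many, more than
    \<open>M - N\<close>.\<close>
  have heavy: "c \<in> C" if "\<And>i. k \<le> i \<Longrightarrow> i < M \<Longrightarrow> (i, c) \<in> T" "k < N" for c k
  proof -
    have "finite {i. (i, c) \<in> T}"
      by (rule finite_subset[of _ "fst ` T"]) (use assms(3) in force)+
    then have "card {k..<M} \<le> card {i. (i, c) \<in> T}"
      using that by (intro card_mono) auto
    then show ?thesis using that(2) by (simp add: C_def)
  qed
  have "E \<subseteq> F Min \<union> F Max \<union> W"
  proof
    fix x assume "x \<in> E"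
    then obtain k j i where x: "x = (k, j, i)" and E: "(k, j, i) \<in> E" by (cases x) auto
    have kl: "k \<in> lev j" using E by (auto simp: lev_def)
    have ij: "(i, j) \<in> T" using own E .
    consider "k = Min (lev j)" | "k = Max (lev j)" | "Min (lev j) < k" "k < Max (lev j)"
      using Min_le[OF fin_lev kl] Max_ge[OF fin_lev kl] by linarith
    then show "x \<in> F Min \<union> F Max \<union> W"
    proof cases
      case 1
      then show ?thesis using ij x by (force simp: F_def)
    next
      case 2
      then show ?thesis using ij x by (force simp: F_def)
    next
      case 3
      \<comment> \<open>An interior level lies above \<open>Min (lev j)\<close>, so it is positive
        and comes from an update with pivot column \<open>k'\<close>.\<close>
      then obtain k' where k': "k = Suc k'" by (cases k) auto
      have v: "k \<le> j" "k \<le> i" "j < N" "i < M" using E assms(2) by (auto simp: version_indices_def)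
      have "Min (lev j) \<in> lev j" "Max (lev j) \<in> lev j"
        using fin_lev kl by (auto intro: Min_in Max_in)
      then have full: "(k, j, i') \<in> E" if "k \<le> i'" "i' < M" for i'
        using 3 that v convex[of "Min (lev j)" j _ "Max (lev j)" _ k i']
        by (auto simp: lev_def version_indices_def)
      have "j \<in> C" using full own v by (intro heavy[of k]) auto
      moreover have "k' \<in> C" using full pivot k' v by (intro heavy[of k]) auto
      ultimately show ?thesis using x k' v by (force simp: W_def)
    qed
  qed
  then have "card E \<le> card (F Min \<union> F Max \<union> W)"
    using card_F card_W by (intro card_mono) auto
  also have "\<dots> \<le> card (F Min) + card (F Max) + card W"
    by (meson add_le_mono1 card_Un_le le_trans)
  also have "\<dots> \<le> 2 * card T + M * (card C)\<^sup>2"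
    using card_F(1)[of Min] card_F(1)[of Max] card_W by linarith
  \<comment> \<open>Scaling by \<open>?D\<^sup>2\<close> lets the bound on
    \<open>card C * ?D\<close> be applied without division.\<close>
  finally have "?D\<^sup>2 * card E \<le> ?D\<^sup>2 * (2 * card T + M * (card C)\<^sup>2)" by simp
  also have "\<dots> = M * (card C * ?D)\<^sup>2 + 2 * ?D\<^sup>2 * card T"
    by (simp only: power_mult_distrib distrib_left mult_ac)
  also have "\<dots> \<le> M * (card T)\<^sup>2 + 2 * ?D\<^sup>2 * card T"
    using C(2) by (simp add: power_mono)
  finally show ?thesis .
qed

section \<open>Dependences of the Householder program\<close>

text \<open>This supplies the in-place hypothesis of \<open>red_touched\<close> and of the path
  lemmas for matrix entries. The analogue for \<open>tau[j]\<close> fails at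
  \<open>Tau_init\<close>.\<close>

lemma matrix_updates_in_place: "writes s = LA i j \<Longrightarrow> LA i j \<in> reads s"
  by (cases s) auto

text \<open>The shift by one makes the level the number of updates already applied. Other writes to
  a matrix entry, such as \<open>Row_update\<close> or \<open>Col_scale\<close>, do not count as
  versions.\<close>

fun version :: "nat \<Rightarrow> nat \<Rightarrow> nat \<Rightarrow> (loc, stmt) node" where
  "version 0 j i = Input (LA i j)"
| "version (Suc k) j i = Inst (Mat_update k j i)"

lemma node_loc_version [simp]: "node_loc writes (version k j i) = LA i j"
  by (cases k) auto

lemma inj_version: "inj (\<lambda>(k, j, i). version k j i)"
proof -
  have "k = k' \<and> j = j' \<and> i = i'" if "version k j i = version k' j' i'" for k j i k' j' i'
    using that by (cases k; cases k') auto
  then show ?thesis by (force simp: inj_on_def)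
qed

lemma set_householder_iter_subset:
  "k < N \<Longrightarrow> set (householder_iter M N k) \<subseteq> set (householder_trace M N)"
  by (fastforce simp: householder_trace_def)

lemma set_householder_col_subset:
  "k < j \<Longrightarrow> j < N \<Longrightarrow> set (householder_col M k j) \<subseteq> set (householder_iter M N k)"
  by (fastforce simp: householder_iter_def)

lemma Mat_update_in_iter:
  assumes "(Suc k, j, i) \<in> version_indices M N"
  shows "Mat_update k j i \<in> set (householder_iter M N k)"
proof -
  have "Mat_update k j i \<in> set (householder_col M k j)"
    using assms by (auto simp: version_indices_def householder_col_def)
  then show ?thesis
    using assms set_householder_col_subset[of k j N M] by (auto simp: version_indices_def)
qed

section \<open>Paths through the reduction into \<open>tau[j]\<close> and its broadcast\<close>

lemma trace_split:
  assumes "k < j" "j < N"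
  obtains xs ys where "householder_trace M N = xs @ householder_col M k j @ ys"
    "\<And>k'. k' < k \<Longrightarrow> set (householder_iter M N k') \<subseteq> set xs"
proof -
  have upt: "[a..<N] = [a..<b] @ b # [Suc b..<N]" if "a \<le> b" "b < N" for a b
    using that by (metis le_Suc_ex less_imp_le upt_add_eq_append upt_conv_Cons)
  have "\<exists>pre post. householder_iter M N k = pre @ householder_col M k j @ post"
    unfolding householder_iter_def using upt[of "k+1" j] assms
    by (simp del: upt_Suc) (metis append_Cons append_assoc)
  then obtain pre post where it: "householder_iter M N k = pre @ householder_col M k j @ post" by blast
  let ?xs = "concat (map (householder_iter M N) [0..<k]) @ pre"
  let ?ys = "post @ concat (map (householder_iter M N) [Suc k..<N])"
  have "householder_trace M N = ?xs @ householder_col M k j @ ?ys"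
    unfolding householder_trace_def using upt[of 0 k] assms it by simp
  then show ?thesis by (rule that) auto
qed

abbreviation qr_path :: "nat \<Rightarrow> nat \<Rightarrow> ((loc, stmt) node \<times> (loc, stmt) node) set" where
  "qr_path M N \<equiv> (edges (householder_cdag M N))\<^sup>+"

text \<open>Upper half of the hourglass: the scalar product for column \<open>j\<close> collects the
  value of every row, and its accumulation runs into \<open>Tau_scale\<close>.\<close>

lemma version_to_tau:
  assumes "k \<le> i" "i < M" "k < j" "j < N"
  shows "(version k j i, Inst (Tau_scale k j)) \<in> qr_path M N"
proof -
  obtain xs zs where tr: "householder_trace M N = xs @ householder_col M k j @ zs"
    and earlier: "\<And>k'. k' < k \<Longrightarrow> set (householder_iter M N k') \<subseteq> set xs"
    using trace_split assms by metis
  \<comment> \<open>Row \<open>k\<close> enters the sum through the initialisation, the rows below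
    it through the additions.\<close>
  define y where "y = (if i = k then Tau_init k j else Tau_add k j i)"
  let ?adds = "map (Tau_add k j) [k+1..<M]"
  let ?rest = "Row_update k j # map (Mat_update k j) [k+1..<M]"
  have col: "householder_col M k j = (Tau_init k j # ?adds) @ Tau_scale k j # ?rest"
    by (simp add: householder_col_def)
  have y: "y \<in> set (Tau_init k j # ?adds)" "LA i j \<in> reads y" "writes y = LTau j"
    using assms by (auto simp: y_def)
  have "(version k j i, Inst y) \<in> qr_path M N"
  proof (cases k)
    case 0
    have "y \<in> set (householder_trace M N)" using y(1) unfolding tr col by auto
    then show ?thesis unfolding householder_cdag_def
      using y 0 matrix_updates_in_place by (auto intro: input_read_path)
  next
    case (Suc k')
    then have "(Suc k', j, i) \<in> version_indices M N"
      using assms by (auto simp: version_indices_def)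
    then have "Mat_update k' j i \<in> set xs"
      using earlier[of k'] Suc Mat_update_in_iter by blast
    moreover have "y \<in> set (householder_col M k j @ zs)" using y(1) unfolding col by auto
    ultimately have "(Inst (Mat_update k' j i), Inst y) \<in> qr_path M N"
      unfolding householder_cdag_def using tr y matrix_updates_in_place
      by (intro append_write_read_path[where l = "LA i j"]) auto
    then show ?thesis using Suc by simp
  qed
  moreover have "(Inst y, Inst (Tau_scale k j)) \<in> qr_path M N"
  proof -
    obtain u v where uv: "Tau_init k j # ?adds = u @ y # v"
      using y(1) by (meson split_list)
    then have v: "set v \<subseteq> set ?adds" by (cases u) auto
    have "householder_trace M N = (xs @ u) @ y # v @ Tau_scale k j # (?rest @ zs)"
      using tr col uv by simp
    then show ?thesis unfolding householder_cdag_def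
      by (rule write_read_path) (use y v in auto)
  qed
  ultimately show ?thesis by (rule trancl_trans)
qed

text \<open>Lower half of the hourglass: between \<open>Tau_scale\<close> and the update only matrix
  entries are written, so every row reads the scaled value.\<close>

lemma tau_to_update:
  assumes "k < i" "i < M" "k < j" "j < N"
  shows "(Inst (Tau_scale k j), Inst (Mat_update k j i)) \<in> qr_path M N"
proof -
  obtain xs zs where tr: "householder_trace M N = xs @ householder_col M k j @ zs"
    using trace_split assms by metis
  have "Mat_update k j i \<in> set (map (Mat_update k j) [k+1..<M])" using assms by simp
  then obtain u v where uv: "map (Mat_update k j) [k+1..<M] = u @ Mat_update k j i # v"
    by (meson split_list)
  have u: "set u \<subseteq> set (map (Mat_update k j) [k+1..<M])" unfolding uv by auto
  have "householder_trace M N = (xs @ Tau_init k j # map (Tau_add k j) [k+1..<M])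
      @ Tau_scale k j # (Row_update k j # u) @ Mat_update k j i # (v @ zs)"
    using tr uv by (simp add: householder_col_def)
  then show ?thesis unfolding householder_cdag_def
    by (rule write_read_path) (use u in auto)
qed

text \<open>The two rows may differ because consecutive levels of a column are joined through the
  single node \<open>Tau_scale\<close>, fed by all rows and read by all later ones.\<close>

lemma version_order:
  assumes "k1 < k2" "(k1, j, i1) \<in> version_indices M N" "(k2, j, i2) \<in> version_indices M N"
  shows "(version k1 j i1, version k2 j i2) \<in> qr_path M N"
  using assms
proof (induction k2 arbitrary: i2)
  case (Suc k)
  have step: "(version k j i, version (Suc k) j i2) \<in> qr_path M N"
    if "(k, j, i) \<in> version_indices M N" for i
    using that Suc.prems version_to_tau[of k i M j N] tau_to_update[of k i2 M j N]
    by (auto simp: version_indices_def)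
  show ?case
  proof (cases "k1 = k")
    case True
    then show ?thesis using step Suc.prems by blast
  next
    case False
    \<comment> \<open>The intermediate version is taken in row \<open>i2\<close>, which exists at
      level \<open>k\<close> because it exists at level \<open>Suc k\<close>.\<close>
    have "(k, j, i2) \<in> version_indices M N" using Suc.prems by (auto simp: version_indices_def)
    then show ?thesis using False Suc step trancl_trans[OF Suc.IH[of i2] step] by auto
  qed
qed simp

lemma Mat_update_in_trace:
  assumes "(Suc k, j, i) \<in> version_indices M N"
  shows "Mat_update k j i \<in> set (householder_trace M N)"
  using Mat_update_in_iter[OF assms] set_householder_iter_subset[of k N M] assms
  by (auto simp: version_indices_def)

text \<open>Iteration 0 already reads the whole matrix: column 0 for the norm, the other columns for
  the scalar products. This forces every initial entry to become red, so that it may be counted as a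
  version.\<close>

lemma input_read:
  assumes "i < M" "j < N"
  obtains s where "s \<in> set (householder_trace M N)" "LA i j \<in> reads s"
proof -
  have "set (householder_iter M N 0) \<subseteq> set (householder_trace M N)"
    using assms by (intro set_householder_iter_subset) auto
  moreover have "\<exists>s \<in> set (householder_iter M N 0). LA i j \<in> reads s"
  proof -
    consider "j = 0" "i = 0" | "j = 0" "0 < i" | "0 < j" "i = 0" | "0 < j" "0 < i" by blast
    then show ?thesis
    proof cases
      case 1
      then show ?thesis
        by (intro bexI[of _ "Norma_sqrt 0"]) (auto simp: householder_iter_def)
    next
      case 2
      then show ?thesis using assms
        by (intro bexI[of _ "Norma2_add 0 i"]) (auto simp: householder_iter_def)
    next
      case 3
      then show ?thesis using assms
        by (intro bexI[of _ "Tau_init 0 j"]) (auto simp: householder_iter_def householder_col_def)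
    next
      case 4
      then have "Tau_add 0 j i \<in> set (householder_col M 0 j)"
        using assms by (simp add: householder_col_def)
      then show ?thesis
        using assms 4 set_householder_col_subset[of 0 j N M]
        by (intro bexI[of _ "Tau_add 0 j i"]) auto
    qed
  qed
  ultimately show ?thesis using that by blast
qed

section \<open>The lower bound\<close>

locale householder_game = pebble_game writes reads "householder_trace M N" S ms
  for M N S :: nat and ms :: "(loc, stmt) node move list" +
  assumes N_less_M: "N < M"
begin

definition versions :: "(loc, stmt) node set" where
  "versions = (\<lambda>(k, j, i). version k j i) ` version_indices M N"

lemma version_path_first:
  assumes "(u, v) \<in> qr_path M N"
  shows "acquired u \<and> acquired v \<and> first u < first v"
  using assms unfolding householder_cdag_def by (rule path_first)

lemma acquired_versions: "v \<in> versions \<Longrightarrow> acquired v"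
proof -
  assume "v \<in> versions"
  then obtain k j i where v: "v = version k j i" "(k, j, i) \<in> version_indices M N"
    by (auto simp: versions_def)
  show "acquired v"
  proof (cases k)
    case 0
    then obtain s where "s \<in> set (householder_trace M N)" "LA i j \<in> reads s"
      using v input_read[of i M j N] by (auto simp: version_indices_def)
    then show ?thesis
      using path_first[OF input_read_path[of s _ "LA i j" reads writes]] matrix_updates_in_place v 0
      by simp
  next
    case (Suc k')
    then show ?thesis using v Mat_update_in_trace acquired_instance by simp
  qed
qed

text \<open>The bound of \<open>hourglass_bound\<close> divided by \<open>(M - N)\<^sup>2\<close>,
  with \<open>K\<close> in place of \<open>card T\<close>.\<close>

definition segment_bound :: "nat \<Rightarrow> real" where
  "segment_bound K = real M * (real K)\<^sup>2 / (real (M - N))\<^sup>2 + 2 * real K"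

lemma mono_segment_bound: "mono segment_bound"
  unfolding segment_bound_def
  by (intro monoI add_mono divide_right_mono mult_left_mono power_mono) auto

lemma card_segment:
  assumes "a \<le> b"
  shows "real (card {v \<in> versions. a < first v \<and> first v \<le> b})
    \<le> segment_bound (card (red a) + (loads b - loads a))"
proof -
  define E where "E = {(k, j, i) \<in> version_indices M N.
    a < first (version k j i) \<and> first (version k j i) \<le> b}"
  define T where "T = {(i, j). LA i j \<in> touched a b}"
  let ?K = "card (red a) + (loads b - loads a)"
  have inj_LA: "inj_on (\<lambda>(i, j). LA i j) T" by (auto simp: inj_on_def)
  have T_sub: "(\<lambda>(i, j). LA i j) ` T \<subseteq> touched a b" by (auto simp: T_def)
  have T: "finite T" "card T \<le> ?K"
    using card_touched[OF assms] T_sub inj_LA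
    by (meson finite_imageD finite_subset, meson card_inj_on_le le_trans)
  have "(M - N)\<^sup>2 * card E \<le> M * (card T)\<^sup>2 + 2 * (M - N)\<^sup>2 * card T"
  proof (rule hourglass_bound[OF N_less_M _ T(1)])
    show "E \<subseteq> version_indices M N" by (auto simp: E_def)
  next
    fix k j i assume "(k, j, i) \<in> E"
    then have *: "(k, j, i) \<in> version_indices M N" "a < first (version k j i)" "first (version k j i) \<le> b"
      by (auto simp: E_def)
    have "acquired (version k j i)" using * by (intro acquired_versions) (force simp: versions_def)
    then have "version k j i \<in> red (first (version k j i))" using first_Suc by metis
    then have "LA i j \<in> touched a b"
      using * matrix_updates_in_place by (intro red_touched[of a _ b "version k j i"]) auto
    then show "(i, j) \<in> T" by (simp add: T_def)
  next
    fix k j i assume "(Suc k, j, i) \<in> E"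
    then have *: "(Suc k, j, i) \<in> version_indices M N" "a < first (Inst (Mat_update k j i))"
      "first (Inst (Mat_update k j i)) \<le> b"
      by (auto simp: E_def)
    have tr: "Mat_update k j i \<in> set (householder_trace M N)" using * Mat_update_in_trace by blast
    \<comment> \<open>The computing move starts at moment \<open>t\<close>, and
      \<open>a < Suc t\<close> puts \<open>t\<close> inside the segment. There the operand
      \<open>A[i][k]\<close> is red; only its location matters, whichever node holds it.\<close>
    obtain t where t: "first (Inst (Mat_update k j i)) = Suc t"
      "preds G (Inst (Mat_update k j i)) \<subseteq> red t"
      using first_compute[OF tr] by blast
    obtain u where u: "(u, Inst (Mat_update k j i)) \<in> edges G" "node_loc writes u = LA i k"
      using read_has_pred[OF tr, of "LA i k" reads writes] by auto
    have "LA i k \<in> touched a b"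
      using * t u matrix_updates_in_place by (intro red_touched[of a t b u]) (auto simp: preds_def)
    then show "(i, k) \<in> T" by (simp add: T_def)
  next
    fix j k1 i1 k i k2 i2
    assume "(k1, j, i1) \<in> E" "(k2, j, i2) \<in> E" "k1 < k" "k < k2" and v: "(k, j, i) \<in> version_indices M N"
    \<comment> \<open>First moments increase along the paths of \<open>version_order\<close>, so an
      intermediate level is caught between two moments of the segment.\<close>
    then have "a < first (version k1 j i1)" "first (version k2 j i2) \<le> b"
      "first (version k1 j i1) < first (version k j i)" "first (version k j i) < first (version k2 j i2)"
      using version_path_first version_order by (auto simp: E_def)
    then show "(k, j, i) \<in> E" using v by (auto simp: E_def)
  qed
  also have "\<dots> \<le> M * ?K\<^sup>2 + 2 * (M - N)\<^sup>2 * ?K"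
    using T(2) by (intro add_mono mult_left_mono power_mono) auto
  finally have "real ((M - N)\<^sup>2 * card E) \<le> real (M * ?K\<^sup>2 + 2 * (M - N)\<^sup>2 * ?K)"
    by (simp only: of_nat_le_iff)
  then have "real (card E) \<le> segment_bound ?K"
    using N_less_M by (simp add: segment_bound_def field_simps del: of_nat_diff)
  moreover have "{v \<in> versions. a < first v \<and> first v \<le> b} = (\<lambda>(k, j, i). version k j i) ` E"
    by (force simp: versions_def E_def)
  ultimately show ?thesis
    by (simp add: card_image[OF inj_on_subset[OF inj_version subset_UNIV]])
qed

lemma num_loads_bound:
  assumes "S > 0"
  shows "(3 * real M - real N) * (real N)\<^sup>2 * (real M - real N)\<^sup>2
    \<le> 24 * (real M * real S + (real M - real N)\<^sup>2) * real (num_loads ms)"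
proof -
  let ?Q = "real (num_loads ms)" and ?V = "real (card versions)"
  define D where "D = real M - real N"
  have D: "D > 0" "real (M - N) = D" using N_less_M by (auto simp: D_def)
  have seg: "D\<^sup>2 * segment_bound K = real M * (real K)\<^sup>2 + 2 * D\<^sup>2 * real K" for K
    unfolding segment_bound_def D(2) using D(1) by (simp add: distrib_left)
  have fin: "finite versions" by (simp add: versions_def finite_version_indices)
  have "card versions = card (version_indices M N)"
    unfolding versions_def by (rule card_image[OF inj_on_subset[OF inj_version subset_UNIV]])
  then have V: "6 * ?V = real N * (real N + 1) * (3 * real M - real N + 1)"
    using card_version_indices N_less_M by simp
  \<comment> \<open>Dropping the two summands 1 from the exact count leaves the factor
    \<open>(3 * M - N) * N\<^sup>2\<close> of the claim.\<close>
  have "(real N) * (real N * (3 * real M - real N)) \<le> real N * ((real N + 1) * (3 * real M - real N + 1))"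
    using N_less_M by (intro mult_left_mono mult_mono) auto
  then have V_ge: "(3 * real M - real N) * (real N)\<^sup>2 \<le> 6 * ?V"
    unfolding V by (simp add: power2_eq_square mult_ac)
  have "D\<^sup>2 * ?V \<le> 4 * (real M * real S + D\<^sup>2) * ?Q"
  proof (rule loads_lower_bound[OF fin acquired_versions assms mono_segment_bound card_segment])
    \<comment> \<open>One factor \<open>?Q\<close> is bounded by \<open>2 * S\<close> and the other
      is kept; this case reaches only half of the allowed value.\<close>
    assume small: "num_loads ms < 2 * S" and b: "?V \<le> segment_bound (num_loads ms)"
    have "D\<^sup>2 * ?V \<le> D\<^sup>2 * segment_bound (num_loads ms)"
      using b by (intro mult_left_mono) auto
    also have "\<dots> = real M * ?Q * ?Q + 2 * D\<^sup>2 * ?Q"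
      unfolding seg by (simp add: power2_eq_square)
    also have "\<dots> \<le> real M * (2 * real S) * ?Q + 2 * D\<^sup>2 * ?Q"
      using small by (intro add_mono mult_right_mono mult_left_mono) auto
    also have "\<dots> \<le> 4 * (real M * real S + D\<^sup>2) * ?Q"
      by (simp add: algebra_simps)
    finally show ?thesis .
  next
    assume "real S * ?V \<le> ?Q * segment_bound (2 * S)"
    then have "D\<^sup>2 * (real S * ?V) \<le> D\<^sup>2 * (?Q * segment_bound (2 * S))"
      by (intro mult_left_mono) auto
    also have "\<dots> = ?Q * (D\<^sup>2 * segment_bound (2 * S))" by (simp only: mult_ac)
    \<comment> \<open>At \<open>K = 2 * S\<close> the scaled bound is
      \<open>4 * S * (M * S + D\<^sup>2)\<close>. The factor \<open>S\<close> cancels, and the 6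
      from the version count turns 4 into 24.\<close>
    also have "\<dots> = real S * (4 * (real M * real S + D\<^sup>2) * ?Q)"
      unfolding seg by (simp add: algebra_simps power2_eq_square)
    finally show ?thesis using assms by (simp add: mult.left_commute[of _ "real S"])
  qed
  moreover have "(3 * real M - real N) * (real N)\<^sup>2 * D\<^sup>2 \<le> (6 * ?V) * D\<^sup>2"
    using V_ge by (intro mult_right_mono) auto
  ultimately have "(3 * real M - real N) * (real N)\<^sup>2 * D\<^sup>2
      \<le> 24 * (real M * real S + D\<^sup>2) * ?Q"
    by (simp add: algebra_simps)
  then show ?thesis by (simp add: D_def)
qed

end

theorem theorem4:
  fixes M N S :: nat
  assumes "M > 0" and "N > 0" and "S > 0" and "M > N"
  shows "ereal ((3 * real M - real N) * (real N)^2 * (real M - real N)^2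
                / (24 * (real M * real S + (real M - real N)^2)))
         \<le> ereal_of_enat (io_complexity (householder_cdag M N) S)"
proof (cases "{ms. complete_game (householder_cdag M N) S ms} = {}")
  \<comment> \<open>Without a complete game the infimum is over the empty set, hence
    infinite.\<close>
  case True
  then show ?thesis by (simp add: io_complexity_def top_enat_def)
next
  case False
  let ?G = "householder_cdag M N"
  \<comment> \<open>Since \<open>enat\<close> is well-ordered, some game attains the
    infimum.\<close>
  have "Inf ((\<lambda>ms. enat (num_loads ms)) ` {ms. complete_game ?G S ms})
      \<in> (\<lambda>ms. enat (num_loads ms)) ` {ms. complete_game ?G S ms}"
    using False by (metis (no_types, lifting) ex_in_conv image_eqI wellorder_InfI)
  then obtain ms where ms: "complete_game ?G S ms" "io_complexity ?G S = enat (num_loads ms)"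
    by (auto simp: io_complexity_def)
  interpret householder_game M N S ms
    by unfold_locales (use ms assms in \<open>auto simp: householder_cdag_def\<close>)
  have "real M * real S + (real M - real N)\<^sup>2 > 0"
    using assms by (intro add_pos_nonneg) auto
  then show ?thesis
    using num_loads_bound[OF assms(3)] by (simp add: ms(2) divide_le_eq mult_ac)
qed

end
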